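(* Consider the problem $\min\{f(x):x\in X,\ g(x)\le0\}$ with a solution $x_*$, and assume that the objective is given as $f(x)=\max_{i\in\{1,\dots,m\}}f_i(x)$, where the functions $f_i$, $i=1,\dots,m$, are differentiable with Lipschitz-continuous gradient: $$\|\nabla f_i(x)-\nabla f_i(y)\|_{E,*}\le L_i\|x-y\|_E\qquad\text{for all }x,y\in X,\ i\in\{1,\dots,m\}.$$ Assume that $|g(x)-g(y)|\le M_g\|x-y\|_E$ for all $x,y\in X$ and some constant $M_g$, and that $\Theta_0>0$ is a known constant with $d(x_* )\le\Theta_0^2$. Let $\varepsilon>0$ and let $\bar x^k$ be the output of the Adaptive Mirror Descent algorithm for general convex objective (described in the context) run with inputs $\varepsilon$ and $\Theta_0$. Then $\bar x^k$ is an $\widetilde\varepsilon$-solution of the problem, i.e. $$f(\bar x^k)-f(x_* )\le\widetilde\varepsilon,\qquad g(\bar x^k)\le\widetilde\varepsilon,$$ where $$\widetilde\varepsilon=\max\Big\{\varepsilon,\ \varepsilon\max_{i=1,\dots,m}\|\nabla f_i(x_* )\|_{E,*}+\frac{\varepsilon^2}{2}\max_{i=1,\dots,m}L_i\Big\}.$$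
   Context: **Problem.** $E$ is a finite-dimensional real vector space with norm $\|\cdot\|_E$, $E^*$ its dual, $\langle p,x\rangle$ the value of $p\in E^*$ at $x\in E$, and $\|p\|_{E,*}=\max\{\langle p,x\rangle:\|x\|_E\le1\}$. $X\subset E$ is closed and convex; $f:X\to\mathbb{R}$ and $g:E\to\mathbb{R}$ are convex. The problem is regular: there is a point $\bar x$ in the relative interior of $X$ with $g(\bar x)<0$. $\nabla f(x)$, $\nabla g(x)$ denote any subgradients of $f$, $g$ at $x$. **Proximal setup.** $d$ is a prox-function: it is continuous and convex on $X$; on the set $X^0\subseteq X$ of points where a subgradient of $d$ exists it admits a continuous selection of subgradients $\nabla d(x)$; it is 1-strongly convex: $d(y)-d(x)-\langle\nabla d(x),y-x\rangle\ge\frac12\|y-x\|_E^2$ for $x\in X^0,y\in X$; and $\min_{x\in X}d(x)=0$. For $z\in X^0$, $x\in X$ the Bregman divergence is $V[z](x)=d(x)-d(z)-\langle\nabla d(z),x-z\rangle$. For $x\in X^0$, $p\in E^*$, $\mathrm{Mirr}[x](p)=\arg\min_{u\in X}\{\langle p,u\rangle+V[x](u)\}$, assumed to be easily computable. **Algorithm.** Start with $x^0=\arg\min_{x\in X}d(x)$, $I=\emptyset$, $k=0$. Repeat: - if $g(x^k)\le\varepsilon$ (productive step): $h_k=\varepsilon/\|\nabla f(x^k)\|_{E,*}$, $x^{k+1}=\mathrm{Mirr}[x^k](h_k\nabla f(x^k))$, and add $k$ to $I$; - otherwise (non-productive step): $h_k=\varepsilon/\|\nabla g(x^k)\|_{E,*}^2$,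 $x^{k+1}=\mathrm{Mirr}[x^k](h_k\nabla g(x^k))$; - set $k\leftarrow k+1$; until $|I|+\sum_{j\in J}\frac1{\|\nabla g(x^j)\|_{E,*}^2}\ge\frac{2\Theta_0^2}{\varepsilon^2}$, where $J=\{0,\dots,k-1\}\setminus I$ and $|I|$ is the number of elements of $I$. Output $\bar x^k=\arg\min_{x^j,\,j\in I}f(x^j)$.
   Formalization: Convexity and subgradients of f, f = max f_i, differentiability and the Lipschitz bounds are assumed on a convex set containing X and the ε-ball around x_*, not only on X (with X alone the bound fails); E has positive dimension. *)

theory Defs
  imports "HOL-Analysis.Analysis"
begin

text \<open>
  The type \<open>'a::euclidean_space\<close> plays the role of the finite-dimensional space \<open>E\<close>. Its built-in
  Euclidean norm only serves as a source of the (unique) vector space topology; the norm of the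
  problem is an arbitrary function \<open>N\<close> satisfying \<open>is_norm\<close>. The dual space is
  \<open>'a \<Rightarrow>\<^sub>L real\<close>, which in finite dimension consists of all linear functionals.
\<close>

definition is_norm :: "('a::real_vector \<Rightarrow> real) \<Rightarrow> bool" where
  "is_norm N \<longleftrightarrow>
     (\<forall>x. 0 \<le> N x) \<and> (\<forall>x. N x = 0 \<longleftrightarrow> x = 0) \<and>
     (\<forall>c x. N (c *\<^sub>R x) = \<bar>c\<bar> * N x) \<and> (\<forall>x y. N (x + y) \<le> N x + N y)"

definition dual_norm :: "('a::real_normed_vector \<Rightarrow> real) \<Rightarrow> ('a \<Rightarrow>\<^sub>L real) \<Rightarrow> real" where
  "dual_norm N p = Sup {blinfun_apply p x | x. N x \<le> 1}"

text \<open>Subgradients of a function whose domain is \<open>S\<close>.\<close>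

definition is_subgradient ::
  "'a::real_normed_vector set \<Rightarrow> ('a \<Rightarrow> real) \<Rightarrow> 'a \<Rightarrow> ('a \<Rightarrow>\<^sub>L real) \<Rightarrow> bool" where
  "is_subgradient S f x p \<longleftrightarrow> x \<in> S \<and> (\<forall>y\<in>S. f y \<ge> f x + blinfun_apply p (y - x))"

definition subdiff_dom :: "'a::real_normed_vector set \<Rightarrow> ('a \<Rightarrow> real) \<Rightarrow> 'a set" where
  "subdiff_dom S f = {x. \<exists>p. is_subgradient S f x p}"

text \<open>\<open>d'\<close> is the continuous selection of subgradients on \<open>subdiff_dom X d\<close>.\<close>

definition prox_function ::
  "('a::real_normed_vector \<Rightarrow> real) \<Rightarrow> 'a set \<Rightarrow> ('a \<Rightarrow> real) \<Rightarrow> ('a \<Rightarrow> 'a \<Rightarrow>\<^sub>L real) \<Rightarrow> bool" where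
  "prox_function N X d d' \<longleftrightarrow>
     continuous_on X d \<and> convex_on X d \<and>
     (\<forall>x\<in>subdiff_dom X d. is_subgradient X d x (d' x)) \<and>
     continuous_on (subdiff_dom X d) d' \<and>
     (\<forall>x\<in>subdiff_dom X d. \<forall>y\<in>X.
        d y - d x - blinfun_apply (d' x) (y - x) \<ge> 1/2 * (N (y - x))\<^sup>2) \<and>
     (\<exists>x\<in>X. d x = 0) \<and> (\<forall>x\<in>X. 0 \<le> d x)"

definition bregman ::
  "('a::real_normed_vector \<Rightarrow> real) \<Rightarrow> ('a \<Rightarrow> 'a \<Rightarrow>\<^sub>L real) \<Rightarrow> 'a \<Rightarrow> 'a \<Rightarrow> real" where
  "bregman d d' z x = d x - d z - blinfun_apply (d' z) (x - z)"

text \<open>\<open>is_Mirr X d d' x p u\<close> says \<open>u = Mirr[x](p)\<close>; the minimiser is unique by strong convexity.\<close>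

definition is_Mirr ::
  "'a::real_normed_vector set \<Rightarrow> ('a \<Rightarrow> real) \<Rightarrow> ('a \<Rightarrow> 'a \<Rightarrow>\<^sub>L real) \<Rightarrow> 'a \<Rightarrow> ('a \<Rightarrow>\<^sub>L real) \<Rightarrow> 'a \<Rightarrow> bool"
  where
  "is_Mirr X d d' x p u \<longleftrightarrow>
     is_arg_min (\<lambda>v. blinfun_apply p v + bregman d d' x v) (\<lambda>v. v \<in> X) u"

text \<open>Sets of productive and non-productive steps among the first \<open>k\<close> iterations.\<close>

definition prod_steps :: "('a \<Rightarrow> real) \<Rightarrow> real \<Rightarrow> (nat \<Rightarrow> 'a) \<Rightarrow> nat \<Rightarrow> nat set" where
  "prod_steps g \<epsilon> x k = {j. j < k \<and> g (x j) \<le> \<epsilon>}"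

definition nonprod_steps :: "('a \<Rightarrow> real) \<Rightarrow> real \<Rightarrow> (nat \<Rightarrow> 'a) \<Rightarrow> nat \<Rightarrow> nat set" where
  "nonprod_steps g \<epsilon> x k = {0..<k} - prod_steps g \<epsilon> x k"

definition amd_stop ::
  "('a::real_normed_vector \<Rightarrow> real) \<Rightarrow> ('a \<Rightarrow> real) \<Rightarrow> real \<Rightarrow> real \<Rightarrow>
   (nat \<Rightarrow> 'a) \<Rightarrow> (nat \<Rightarrow> 'a \<Rightarrow>\<^sub>L real) \<Rightarrow> nat \<Rightarrow> bool" where
  "amd_stop N g \<epsilon> \<Theta>\<^sub>0 x pg k \<longleftrightarrow>
     real (card (prod_steps g \<epsilon> x k))
       + (\<Sum>j\<in>nonprod_steps g \<epsilon> x k. 1 / (dual_norm N (pg j))\<^sup>2)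
     \<ge> 2 * \<Theta>\<^sub>0\<^sup>2 / \<epsilon>\<^sup>2"

text \<open>
  \<open>pf k\<close> and \<open>pg k\<close> are the subgradients of \<open>f\<close> (with domain \<open>D\<close>) and of \<open>g\<close> (with domain the whole
  space) that are used in step \<open>k\<close>. If \<open>pf k = 0\<close>, then the step size is \<open>\<epsilon> / 0 = 0\<close> and the
  iterate does not move.
\<close>

definition amd_step ::
  "('a::real_normed_vector \<Rightarrow> real) \<Rightarrow> 'a set \<Rightarrow> ('a \<Rightarrow> real) \<Rightarrow> ('a \<Rightarrow> 'a \<Rightarrow>\<^sub>L real) \<Rightarrow>
   'a set \<Rightarrow> ('a \<Rightarrow> real) \<Rightarrow> ('a \<Rightarrow> real) \<Rightarrow> real \<Rightarrow>
   (nat \<Rightarrow> 'a) \<Rightarrow> (nat \<Rightarrow> 'a \<Rightarrow>\<^sub>L real) \<Rightarrow> (nat \<Rightarrow> 'a \<Rightarrow>\<^sub>L real) \<Rightarrow> nat \<Rightarrow> bool" where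
  "amd_step N X d d' D f g \<epsilon> x pf pg k \<longleftrightarrow>
     (if g (x k) \<le> \<epsilon>
      then is_subgradient D f (x k) (pf k) \<and>
           is_Mirr X d d' (x k) ((\<epsilon> / dual_norm N (pf k)) *\<^sub>R pf k) (x (Suc k))
      else is_subgradient UNIV g (x k) (pg k) \<and>
           is_Mirr X d d' (x k) ((\<epsilon> / (dual_norm N (pg k))\<^sup>2) *\<^sub>R pg k) (x (Suc k)))"

text \<open>
  A run that stops after \<open>K\<close> iterations. The stopping test is performed at the end of the loop body,
  so at least one iteration takes place.
\<close>

definition amd_run ::
  "('a::real_normed_vector \<Rightarrow> real) \<Rightarrow> 'a set \<Rightarrow> ('a \<Rightarrow> real) \<Rightarrow> ('a \<Rightarrow> 'a \<Rightarrow>\<^sub>L real) \<Rightarrow>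
   'a set \<Rightarrow> ('a \<Rightarrow> real) \<Rightarrow> ('a \<Rightarrow> real) \<Rightarrow> real \<Rightarrow> real \<Rightarrow>
   (nat \<Rightarrow> 'a) \<Rightarrow> (nat \<Rightarrow> 'a \<Rightarrow>\<^sub>L real) \<Rightarrow> (nat \<Rightarrow> 'a \<Rightarrow>\<^sub>L real) \<Rightarrow> nat \<Rightarrow> bool" where
  "amd_run N X d d' D f g \<epsilon> \<Theta>\<^sub>0 x pf pg K \<longleftrightarrow>
     is_arg_min d (\<lambda>u. u \<in> X) (x 0) \<and>
     (\<forall>k<K. amd_step N X d d' D f g \<epsilon> x pf pg k) \<and>
     1 \<le> K \<and> amd_stop N g \<epsilon> \<Theta>\<^sub>0 x pg K \<and>
     (\<forall>k. 1 \<le> k \<and> k < K \<longrightarrow> \<not> amd_stop N g \<epsilon> \<Theta>\<^sub>0 x pg k)"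

definition amd_output ::
  "('a \<Rightarrow> real) \<Rightarrow> ('a \<Rightarrow> real) \<Rightarrow> real \<Rightarrow> (nat \<Rightarrow> 'a) \<Rightarrow> nat \<Rightarrow> 'a \<Rightarrow> bool" where
  "amd_output f g \<epsilon> x K xbar \<longleftrightarrow> is_arg_min f (\<lambda>u. u \<in> x ` prod_steps g \<epsilon> x K) xbar"

text \<open>
  On the set \<open>D\<close>: the error bound is obtained by comparing an iterate with a point at distance at
  most \<open>\<epsilon>\<close> from the solution \<open>x\<^sub>*\<close>, and this point need not lie in \<open>X\<close>. Therefore \<open>f\<close> and its
  components live on a convex set \<open>D\<close> that contains \<open>X\<close> and the ball of radius \<open>\<epsilon>\<close> around
  \<open>x\<^sub>*\<close>; possible choices are the whole space, and \<open>X\<close> itself if it contains that ball.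
  Without such a condition the bound fails. For example, let \<open>E\<close> be the Euclidean plane,
  \<open>X = [-1,0] \<times> {0}\<close>, \<open>d(z) = |z|^2 / 2\<close>, \<open>g = -1\<close>, \<open>m = 1\<close> and
  \<open>f(u,v) = u + c (u + 1) v + a (u + 1)^2 / 2 + c^2 v^2 / (2 a)\<close> with small \<open>a\<close>, \<open>\<epsilon>\<close> and \<open>c = 4 / \<epsilon>\<close>.
  On \<open>X\<close> the gradient has Lipschitz constant \<open>sqrt (a^2 + c^2)\<close>, and so the claimed bound is
  about \<open>3 \<epsilon>\<close>, but the error of the output is about \<open>0.7\<close>.
\<close>

end

theory Submission
  imports Defs
begin

text \<open>
  Every iterate is compared with the solution \<open>x\<^sub>*\<close> through the Bregman divergence
  \<open>V[x\<^sup>k](x\<^sub>*)\<close>. A mirror step with direction \<open>p\<close> decreases it by at least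
  \<open>\<langle>p, x\<^sup>k - x\<^sub>*\<rangle> - \<parallel>p\<parallel>\<^sup>2 / 2\<close> (\<open>mirror_step\<close>). Call a productive step good if
  \<open>\<langle>\<nabla>f(x\<^sup>j), x\<^sup>j - x\<^sub>*\<rangle> \<le> \<epsilon> \<parallel>\<nabla>f(x\<^sup>j)\<parallel>\<close>, that is, if \<open>x\<^sub>*\<close> is within distance \<open>\<epsilon>\<close>
  of the half-space on which the linearisation of \<open>f\<close> at \<open>x\<^sup>j\<close> is at least \<open>f(x\<^sup>j)\<close>.
  The step sizes are chosen such that a productive step that is not good decreases the divergence by
  more than \<open>\<epsilon>\<^sup>2 / 2\<close>, and every non-productive step by more than
  \<open>\<epsilon>\<^sup>2 / (2 \<parallel>\<nabla>g(x\<^sup>j)\<parallel>\<^sup>2)\<close>, because there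
  \<open>\<langle>\<nabla>g(x\<^sup>j), x\<^sup>j - x\<^sub>*\<rangle> \<ge> g(x\<^sup>j) - g(x\<^sub>*) > \<epsilon>\<close>. Without a good step the stopping rule would
  force a total decrease of more than \<open>\<Theta>\<^sub>0\<^sup>2\<close>, whereas the divergence is nonnegative and starts at
  most at \<open>d(x\<^sub>*) \<le> \<Theta>\<^sub>0\<^sup>2\<close>; so there is a good step (\<open>amd_good_productive_step\<close>).

  For a good step \<open>j\<close>, move from \<open>x\<^sub>*\<close> by \<open>\<epsilon>\<close> in the direction in which \<open>\<nabla>f(x\<^sup>j)\<close> grows
  fastest. This reaches that half-space, so the resulting point \<open>z\<close> has \<open>f(x\<^sup>j) \<le> f(z)\<close>
  (\<open>subgradient_le_at_distance\<close>). The descent lemma, applied to the components of \<open>f\<close>,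
  bounds \<open>f(z) - f(x\<^sub>*)\<close> by the second term of the claimed accuracy (\<open>max_smooth_bound\<close>).

  The delicate point is the mirror step. Optimality of \<open>u = Mirr[x](p)\<close> provides one particular
  subgradient of \<open>d\<close> at \<open>u\<close>, namely \<open>\<nabla>d(x) - p\<close>, but the divergence from \<open>u\<close> uses the selected
  one, and the two may differ, for instance when \<open>u\<close> is on the boundary of \<open>X\<close>. Continuity of the selection
  bridges this gap (\<open>minimiser_variational_inequality\<close>).
\<close>

section \<open>Norms and dual norms in finite dimension\<close>

lemma is_normD:
  assumes "is_norm N"
  shows "0 \<le> N x" "N x = 0 \<longleftrightarrow> x = 0" "N (c *\<^sub>R x) = \<bar>c\<bar> * N x" "N (x + y) \<le> N x + N y"
  using assms by (auto simp: is_norm_def)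

lemma is_norm_convex_on:
  assumes "is_norm N"
  shows "convex_on UNIV N"
proof (rule convex_onI)
  fix t :: real and x y assume "0 < t" "t < 1"
  then show "N ((1 - t) *\<^sub>R x + t *\<^sub>R y) \<le> (1 - t) * N x + t * N y"
    using is_normD(4)[OF assms, of "(1 - t) *\<^sub>R x" "t *\<^sub>R y"] by (simp add: is_normD(3)[OF assms])
qed simp

lemma is_norm_continuous_on:
  fixes N :: "'a::euclidean_space \<Rightarrow> real"
  assumes "is_norm N"
  shows "continuous_on UNIV N"
  by (rule convex_on_continuous[OF open_UNIV is_norm_convex_on[OF assms]])

text \<open>The constant is the minimum of \<open>N\<close> on the Euclidean unit sphere.\<close>

lemma is_norm_dominates_norm:
  fixes N :: "'a::euclidean_space \<Rightarrow> real"
  assumes N: "is_norm N"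
  obtains c where "0 < c" "\<And>x. c * norm x \<le> N x"
proof -
  have cont: "continuous_on (sphere 0 1) N"
    using is_norm_continuous_on[OF N] by (rule continuous_on_subset) simp
  obtain b :: 'a where "b \<in> Basis" using nonempty_Basis by blast
  then have ne: "sphere (0::'a) 1 \<noteq> {}" by auto
  obtain s where s: "s \<in> sphere 0 1" "\<And>y. y \<in> sphere 0 1 \<Longrightarrow> N s \<le> N y"
    using continuous_attains_inf[OF compact_sphere ne cont] by auto
  have "s \<noteq> 0" using s(1) by auto
  then have pos: "0 < N s" using is_normD(1,2)[OF N, of s] by linarith
  have "N s * norm x \<le> N x" for x
  proof (cases "x = 0")
    case True
    then show ?thesis using is_normD(1)[OF N] by simp
  next
    case False
    then have "N s \<le> N ((1 / norm x) *\<^sub>R x)" by (intro s(2)) simp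
    with False show ?thesis by (simp add: is_normD(3)[OF N] field_simps)
  qed
  with pos that show ?thesis by blast
qed

text \<open>
  The unit sphere of \<open>N\<close> is compact. A maximiser on the sphere also maximises on the whole ball,
  because the maximum is nonnegative by symmetry. That \<open>N e\<close> is exactly \<open>1\<close>, even for \<open>p = 0\<close>,
  later provides a comparison point at distance exactly \<open>\<epsilon>\<close>, so that the quadratic term of the
  descent lemma becomes exactly \<open>L \<epsilon>\<^sup>2 / 2\<close>.
\<close>

lemma dual_norm_attained:
  fixes N :: "'a::euclidean_space \<Rightarrow> real"
  assumes N: "is_norm N"
  obtains e where "N e = 1" "blinfun_apply p e = dual_norm N p"
    "\<And>x. blinfun_apply p x \<le> dual_norm N p * N x"
proof -
  obtain c where c: "0 < c" "\<And>x. c * norm x \<le> N x"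
    using is_norm_dominates_norm[OF N] by blast
  let ?S = "{x. N x = 1}"
  have scale: "N ((1 / N x) *\<^sub>R x) = 1" if "x \<noteq> 0" for x
    using that is_normD(1,2)[OF N, of x] by (simp add: is_normD(3)[OF N])
  have "norm x \<le> 1 / c" if "x \<in> ?S" for x
    using c(2)[of x] c(1) that by (simp add: field_simps)
  then have "bounded ?S" by (auto simp: bounded_iff)
  moreover have "closed ?S"
    using closed_Collect_eq[OF is_norm_continuous_on[OF N] continuous_on_const] .
  ultimately have "compact ?S" by (simp add: compact_eq_bounded_closed)
  moreover obtain b :: 'a where "b \<in> Basis" using nonempty_Basis by blast
  then have "?S \<noteq> {}" using scale[of b] by (auto dest: nonzero_Basis)
  moreover have "continuous_on ?S (blinfun_apply p)"
    by (intro continuous_intros)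
  ultimately obtain e where e: "N e = 1" and max: "\<And>y. N y = 1 \<Longrightarrow> p y \<le> p e"
    using continuous_attains_sup[of ?S "blinfun_apply p"] by auto
  have bound: "p x \<le> p e * N x" for x
  proof (cases "x = 0")
    case True
    then show ?thesis using is_normD(2)[OF N, of 0] by simp
  next
    case False
    have "0 < N x" using False is_normD(1,2)[OF N, of x] by linarith
    with max[OF scale[OF False]] show ?thesis by (simp add: blinfun.scaleR_right field_simps)
  qed
  have "N (- e) = 1" using e is_normD(3)[OF N, of "- 1" e] by simp
  then have nonneg: "0 \<le> p e" using max[of "- e"] by (simp add: blinfun.minus_right)
  have "dual_norm N p = p e"
    unfolding dual_norm_def
  proof (rule cSup_eq_maximum)
    show "p e \<in> {p x |x. N x \<le> 1}" using e by force
  next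
    fix v assume "v \<in> {p x |x. N x \<le> 1}"
    then obtain x where "v = p x" "N x \<le> 1" by blast
    then show "v \<le> p e"
      using bound[of x] mult_left_mono[of "N x" 1 "p e"] nonneg by simp
  qed
  with that e bound show ?thesis by simp
qed

lemma dual_norm_bound:
  fixes N :: "'a::euclidean_space \<Rightarrow> real"
  assumes "is_norm N"
  shows "blinfun_apply p x \<le> dual_norm N p * N x"
  using dual_norm_attained[OF assms, of p] by blast

lemma dual_norm_nonneg:
  fixes N :: "'a::euclidean_space \<Rightarrow> real"
  assumes N: "is_norm N"
  shows "0 \<le> dual_norm N p"
proof -
  obtain e where e: "N e = 1" "blinfun_apply p e = dual_norm N p"
    using dual_norm_attained[OF N, of p] by blast
  have "N (- e) = 1" using e is_normD(3)[OF N, of "- 1" e] by simp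
  then show ?thesis using dual_norm_bound[OF N, of p "- e"] e by (simp add: blinfun.minus_right)
qed

section \<open>Optimality with respect to a continuous selection of subgradients\<close>

text \<open>
  A subgradient at \<open>z\<close> is the slope of a hyperplane that supports the epigraph at \<open>(z, f z)\<close>. The
  hyperplane is not vertical: a vertical one would support \<open>S\<close> at the relative interior point
  \<open>z\<close>, so it would contain the whole of \<open>S\<close>, contrary to the strict inequality on the relative
  interior of the epigraph.
\<close>

lemma rel_interior_subset_subdiff_dom:
  fixes f :: "'a::euclidean_space \<Rightarrow> real"
  assumes f: "convex_on S f"
  shows "rel_interior S \<subseteq> subdiff_dom S f"
proof
  fix z assume z: "z \<in> rel_interior S"
  then have zS: "z \<in> S" using rel_interior_subset by blast
  have S: "convex S" using f by (simp add: convex_on_def)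
  let ?E = "epigraph S f"
  have E: "convex ?E" using f by (simp add: convex_epigraph)
  have zE: "(z, f z) \<in> ?E" using zS by (simp add: epigraph_def)
  \<comment> \<open>From a relative interior point one could move on slightly below the graph.\<close>
  have boundary: "(z, f z) \<notin> rel_interior ?E"
  proof
    assume "(z, f z) \<in> rel_interior ?E"
    moreover have "(z, f z + 1) \<in> ?E" using zS by (simp add: epigraph_def)
    ultimately obtain e where "e > 1"
      and "(1 - e) *\<^sub>R (z, f z + 1) + e *\<^sub>R (z, f z) \<in> ?E"
      using convex_rel_interior_iff[OF E, of "(z, f z)"] zE by blast
    then show False by (simp add: epigraph_def algebra_simps)
  qed
  obtain a where a: "\<And>y. y \<in> ?E \<Longrightarrow> a \<bullet> (z, f z) \<le> a \<bullet> y"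
    and strict: "\<And>y. y \<in> rel_interior ?E \<Longrightarrow> a \<bullet> (z, f z) < a \<bullet> y"
    using supporting_hyperplane_rel_boundary[OF E zE boundary] by blast
  obtain b \<beta> where ab: "a = (b, \<beta>)" by (cases a)
  have le: "b \<bullet> z + \<beta> * f z \<le> b \<bullet> y + \<beta> * r" if "y \<in> S" "f y \<le> r" for y r
    using a[of "(y, r)"] that by (simp add: ab epigraph_def)
  have "0 \<le> \<beta>" using le[OF zS, of "f z + 1"] by (simp add: algebra_simps)
  moreover have "\<beta> \<noteq> 0"
  proof
    assume 0: "\<beta> = 0"
    obtain w where w: "w \<in> rel_interior ?E"
      using rel_interior_eq_empty[OF E] zE by blast
    obtain y r where "w = (y, r)" by (cases w)
    with w have "(y, r) \<in> ?E" using rel_interior_subset by blast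
    then have y: "y \<in> S" by (simp add: epigraph_def)
    have lt: "b \<bullet> z < b \<bullet> y" using strict[OF w] \<open>w = (y, r)\<close> by (simp add: ab 0)
    \<comment> \<open>Prolonging the segment from \<open>y\<close> to \<open>z\<close> beyond \<open>z\<close> leaves the supported side.\<close>
    obtain e where e: "e > 1" "(1 - e) *\<^sub>R y + e *\<^sub>R z \<in> S"
      using z y convex_rel_interior_iff[OF S, of z] by blast
    have "b \<bullet> z \<le> (1 - e) * (b \<bullet> y) + e * (b \<bullet> z)"
      using le[OF e(2) order_refl] by (simp add: 0 inner_add_right)
    then have "(e - 1) * (b \<bullet> y) \<le> (e - 1) * (b \<bullet> z)" by (simp add: algebra_simps)
    with e lt show False by simp
  qed
  ultimately have "0 < \<beta>" by simp
  have "f y \<ge> f z + blinfun_inner_right (- (1 / \<beta>) *\<^sub>R b) (y - z)" if "y \<in> S" for y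
    using le[OF that order_refl] \<open>0 < \<beta>\<close>
    by (simp add: field_simps inner_diff_right)
  then have "is_subgradient S f z (blinfun_inner_right (- (1 / \<beta>) *\<^sub>R b))"
    using zS by (simp add: is_subgradient_def)
  then show "z \<in> subdiff_dom S f" by (auto simp: subdiff_dom_def)
qed

lemma prox_functionD:
  assumes "prox_function N X d d'"
  shows "convex_on X d" "continuous_on (subdiff_dom X d) d'"
    "\<And>x y. x \<in> subdiff_dom X d \<Longrightarrow> y \<in> X \<Longrightarrow> d y \<ge> d x + blinfun_apply (d' x) (y - x)"
    "\<And>x y. x \<in> subdiff_dom X d \<Longrightarrow> y \<in> X \<Longrightarrow> (N (y - x))\<^sup>2 / 2 \<le> bregman d d' x y"
    "\<And>x. x \<in> X \<Longrightarrow> 0 \<le> d x"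
  using assms by (auto simp: prox_function_def is_subgradient_def bregman_def)

lemma subdiff_dom_subset: "subdiff_dom X d \<subseteq> X"
  by (auto simp: subdiff_dom_def is_subgradient_def)

lemma minimiser_in_subdiff_dom:
  assumes "is_arg_min (\<lambda>v. blinfun_apply q v + d v) (\<lambda>v. v \<in> X) u"
  shows "u \<in> subdiff_dom X d"
proof -
  have "is_subgradient X d u (- q)"
    using assms by (force simp: is_arg_min_linorder is_subgradient_def blinfun.minus_left blinfun.diff_right)
  then show ?thesis by (auto simp: subdiff_dom_def)
qed

text \<open>
  The first-order condition for minimising \<open>q + d\<close> over \<open>X\<close>, with the selected subgradient.
  For an arbitrary subgradient at \<open>u\<close> it can fail, so it cannot be read off at \<open>u\<close>
  itself. Approach \<open>u\<close> along a segment from a point \<open>c\<close> of the relative interior: subgradients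
  exist on this segment, and combining minimality of \<open>u\<close> with the subgradient inequality at a point
  of the segment yields the condition there, in the direction \<open>c - u\<close>. Continuity of the selection
  carries it to \<open>u\<close>, and density of the relative interior extends it to all \<open>y\<close> in \<open>X\<close>.
\<close>

lemma minimiser_variational_inequality:
  fixes X :: "'a::euclidean_space set"
  assumes prox: "prox_function N X d d'"
    and min: "is_arg_min (\<lambda>v. blinfun_apply q v + d v) (\<lambda>v. v \<in> X) u"
    and y: "y \<in> X"
  shows "0 \<le> blinfun_apply (q + d' u) (y - u)"
proof -
  note d = prox_functionD[OF prox]
  have X: "convex X" using d(1) by (simp add: convex_on_def)
  have u0: "u \<in> subdiff_dom X d" using minimiser_in_subdiff_dom[OF min] .
  then have u: "u \<in> X" using subdiff_dom_subset by blast
  let ?H = "{y. 0 \<le> blinfun_apply (q + d' u) (y - u)}"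
  have "rel_interior X \<subseteq> ?H"
  proof
    fix c assume c: "c \<in> rel_interior X"
    define t where "t n = inverse (real (Suc n))" for n
    define w where "w n = u - t n *\<^sub>R (u - c)" for n
    have t: "0 < t n" "t n \<le> 1" for n by (auto simp: t_def field_simps)
    have w: "w n \<in> subdiff_dom X d" for n
      using rel_interior_convex_shrink[OF X c u t] rel_interior_subset_subdiff_dom[OF d(1)]
      by (auto simp: w_def)
    have nonneg: "0 \<le> blinfun_apply (q + d' (w n)) (c - u)" for n
    proof -
      have "w n \<in> X" using w subdiff_dom_subset by blast
      then have "q u + d u \<le> q (w n) + d (w n)"
        using min by (auto simp: is_arg_min_linorder)
      moreover have "d u \<ge> d (w n) + d' (w n) (u - w n)"
        using d(3)[OF w u] .
      ultimately have "0 \<le> blinfun_apply (q + d' (w n)) (w n - u)"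
        by (simp add: blinfun.add_left blinfun.diff_right)
      also have "w n - u = t n *\<^sub>R (c - u)"
        by (simp add: w_def algebra_simps)
      finally show ?thesis using t(1)[of n] by (simp add: blinfun.scaleR_right zero_le_mult_iff)
    qed
    have "t \<longlonglongrightarrow> 0" unfolding t_def by (rule LIMSEQ_inverse_real_of_nat)
    then have "w \<longlonglongrightarrow> u - 0 *\<^sub>R (u - c)"
      unfolding w_def by (intro tendsto_intros)
    then have "w \<longlonglongrightarrow> u" by simp
    then have "(\<lambda>n. d' (w n)) \<longlonglongrightarrow> d' u"
      by (rule continuous_on_tendsto_compose[OF d(2) _ u0]) (simp add: w)
    then have "(\<lambda>n. blinfun_apply (q + d' (w n)) (c - u)) \<longlonglongrightarrow> blinfun_apply (q + d' u) (c - u)"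
      by (intro tendsto_intros)
    then show "c \<in> ?H"
      using nonneg by (auto intro: tendsto_lowerbound)
  qed
  moreover have "closed ?H"
    by (intro closed_Collect_le continuous_intros)
  ultimately have "closure (rel_interior X) \<subseteq> ?H" by (rule closure_minimal)
  then have "X \<subseteq> ?H"
    using convex_closure_rel_interior[OF X] closure_subset by blast
  with y show ?thesis by blast
qed

section \<open>The mirror step\<close>

text \<open>Only the terms of the Bregman divergence that depend on the second point affect the minimiser.\<close>

lemma is_Mirr_iff:
  "is_Mirr X d d' x p u \<longleftrightarrow> is_arg_min (\<lambda>v. blinfun_apply (p - d' x) v + d v) (\<lambda>v. v \<in> X) u"
  by (auto simp: is_Mirr_def is_arg_min_linorder bregman_def blinfun.diff_left blinfun.diff_right algebra_simps)

text \<open>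
  The three-point identity
  \<open>\<langle>d' u - d' x, y - u\<rangle> = V[x](y) - V[u](y) - V[x](u)\<close> turns the variational inequality into a
  bound on \<open>\<langle>p, u - y\<rangle>\<close>. The remaining part \<open>\<langle>p, x - u\<rangle> \<le> B N(u - x)\<close> is absorbed by
  \<open>V[x](u) \<ge> N(u - x)\<^sup>2 / 2\<close> at the price of \<open>B\<^sup>2 / 2\<close>.
\<close>

lemma mirror_step:
  fixes X :: "'a::euclidean_space set"
  assumes norm: "is_norm N" and prox: "prox_function N X d d'"
    and x: "x \<in> subdiff_dom X d" and mirr: "is_Mirr X d d' x p u" and y: "y \<in> X"
    and bound: "\<And>v. blinfun_apply p v \<le> B * N v"
  shows "u \<in> subdiff_dom X d"
    and "blinfun_apply p (x - y) \<le> bregman d d' x y - bregman d d' u y + B\<^sup>2 / 2"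
proof -
  note min = mirr[unfolded is_Mirr_iff]
  show u0: "u \<in> subdiff_dom X d" using minimiser_in_subdiff_dom[OF min] .
  then have u: "u \<in> X" using subdiff_dom_subset by blast
  have "0 \<le> blinfun_apply (p - d' x + d' u) (y - u)"
    using minimiser_variational_inequality[OF prox min y] .
  then have three: "p (u - y) \<le> bregman d d' x y - bregman d d' u y - bregman d d' x u"
    by (simp add: bregman_def blinfun.add_left blinfun.diff_left blinfun.diff_right)
  have "N (x - u) = N (u - x)" using is_normD(3)[OF norm, of "- 1" "x - u"] by simp
  then have "p (x - u) \<le> B * N (u - x)" using bound[of "x - u"] by simp
  also have "\<dots> \<le> B\<^sup>2 / 2 + (N (u - x))\<^sup>2 / 2"
    using sum_squares_bound[of B "N (u - x)"] by simp
  also have "\<dots> \<le> B\<^sup>2 / 2 + bregman d d' x u"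
    using prox_functionD(4)[OF prox x u] by simp
  finally show "p (x - y) \<le> bregman d d' x y - bregman d d' u y + B\<^sup>2 / 2"
    using three by (simp add: blinfun.diff_right)
qed

text \<open>The variational inequality with \<open>q = 0\<close> makes the linear term of \<open>V[x](y)\<close> harmless.\<close>

lemma bregman_initial:
  fixes X :: "'a::euclidean_space set"
  assumes prox: "prox_function N X d d'" and min: "is_arg_min d (\<lambda>u. u \<in> X) x" and y: "y \<in> X"
  shows "x \<in> subdiff_dom X d" and "bregman d d' x y \<le> d y"
proof -
  have min0: "is_arg_min (\<lambda>v. blinfun_apply 0 v + d v) (\<lambda>v. v \<in> X) x" using min by simp
  show "x \<in> subdiff_dom X d" using minimiser_in_subdiff_dom[OF min0] .
  have "0 \<le> d' x (y - x)" using minimiser_variational_inequality[OF prox min0 y] by simp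
  moreover have "0 \<le> d x"
    using min prox_functionD(5)[OF prox] by (simp add: is_arg_min_linorder)
  ultimately show "bregman d d' x y \<le> d y" by (simp add: bregman_def)
qed

section \<open>Existence of a good productive step\<close>

text \<open>
  The weight \<open>w\<close> is the contribution of step \<open>k\<close> to the left-hand side of the stopping rule. Both
  step sizes are such that the gain \<open>\<langle>p, x\<^sup>k - y\<rangle>\<close> exceeds \<open>\<epsilon>\<^sup>2 w\<close> while the loss
  \<open>B\<^sup>2 / 2\<close> of the mirror step equals \<open>\<epsilon>\<^sup>2 w / 2\<close>. For a non-productive step the gain comes from
  the violated constraint; for a productive step it is the assumption that \<open>y\<close> is far from the
  half-space cut out by the subgradient.
\<close>

lemma amd_step_decrease:
  fixes X :: "'a::euclidean_space set"
  assumes norm: "is_norm N" and prox: "prox_function N X d d'" and eps: "0 < \<epsilon>"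
    and x: "x k \<in> subdiff_dom X d"
    and step: "amd_step N X d d' D f g \<epsilon> x pf pg k"
    and y: "y \<in> X" "g y \<le> 0"
    and far: "g (x k) \<le> \<epsilon> \<Longrightarrow> \<epsilon> * dual_norm N (pf k) < blinfun_apply (pf k) (x k - y)"
  defines "w \<equiv> (if g (x k) \<le> \<epsilon> then 1 else 1 / (dual_norm N (pg k))\<^sup>2)"
  shows "x (Suc k) \<in> subdiff_dom X d"
    and "\<epsilon>\<^sup>2 / 2 * w < bregman d d' (x k) y - bregman d d' (x (Suc k)) y"
proof -
  have main: "x (Suc k) \<in> subdiff_dom X d \<and>
    \<epsilon>\<^sup>2 / 2 * w < bregman d d' (x k) y - bregman d d' (x (Suc k)) y"
  proof (cases "g (x k) \<le> \<epsilon>")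
    case True
    let ?n = "dual_norm N (pf k)"
    have mirr: "is_Mirr X d d' (x k) ((\<epsilon> / ?n) *\<^sub>R pf k) (x (Suc k))"
      using step True by (simp add: amd_step_def)
    have "pf k (x k - y) \<le> ?n * N (x k - y)" using dual_norm_bound[OF norm] .
    with far[OF True] have "?n \<noteq> 0" by auto
    then have n: "0 < ?n" using dual_norm_nonneg[OF norm, of "pf k"] by linarith
    have "((\<epsilon> / ?n) *\<^sub>R pf k) v \<le> \<epsilon> * N v" for v
      using dual_norm_bound[OF norm, of "pf k" v] n eps
      by (simp add: blinfun.scaleR_left field_simps)
    note ms = mirror_step[OF norm prox x mirr y(1) this]
    have "\<epsilon>\<^sup>2 < ((\<epsilon> / ?n) *\<^sub>R pf k) (x k - y)"
      using far[OF True] n eps by (simp add: blinfun.scaleR_left field_simps power2_eq_square)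
    with ms show ?thesis using True by (simp add: w_def)
  next
    case False
    let ?n = "dual_norm N (pg k)"
    have mirr: "is_Mirr X d d' (x k) ((\<epsilon> / ?n\<^sup>2) *\<^sub>R pg k) (x (Suc k))"
      and sub: "is_subgradient UNIV g (x k) (pg k)"
      using step False by (simp_all add: amd_step_def)
    have "g y \<ge> g (x k) + pg k (y - x k)" using sub by (simp add: is_subgradient_def)
    with False y(2) have far': "\<epsilon> < pg k (x k - y)" by (simp add: blinfun.diff_right)
    have "pg k (x k - y) \<le> ?n * N (x k - y)" using dual_norm_bound[OF norm] .
    with far' eps have "?n \<noteq> 0" by auto
    then have n: "0 < ?n" using dual_norm_nonneg[OF norm, of "pg k"] by linarith
    have "((\<epsilon> / ?n\<^sup>2) *\<^sub>R pg k) v \<le> \<epsilon> / ?n * N v" for v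
      using mult_left_mono[OF dual_norm_bound[OF norm, of "pg k" v], of "\<epsilon> / ?n\<^sup>2"] n eps
      by (simp add: blinfun.scaleR_left power2_eq_square)
    note ms = mirror_step[OF norm prox x mirr y(1) this]
    have "\<epsilon> / ?n\<^sup>2 * \<epsilon> < ((\<epsilon> / ?n\<^sup>2) *\<^sub>R pg k) (x k - y)"
      unfolding blinfun.scaleR_left real_scaleR_def
      by (rule mult_strict_left_mono[OF far']) (use n eps in simp)
    moreover have "\<epsilon> / ?n\<^sup>2 * \<epsilon> = (\<epsilon> / ?n)\<^sup>2 / 2 + \<epsilon>\<^sup>2 / 2 * (1 / ?n\<^sup>2)"
      by (simp add: power_divide power2_eq_square)
    ultimately show ?thesis using ms False by (simp add: w_def)
  qed
  show "x (Suc k) \<in> subdiff_dom X d" using main ..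
  show "\<epsilon>\<^sup>2 / 2 * w < bregman d d' (x k) y - bregman d d' (x (Suc k)) y" using main ..
qed

text \<open>
  If the stated inequality failed at every productive step, the decreases would telescope to a total of more
  than \<open>\<Theta>\<^sub>0\<^sup>2\<close>, which is more than the divergence has to lose. The contradiction
  relies on strictness of the decreases and on at least one step being made.
\<close>

lemma amd_good_productive_step:
  fixes X :: "'a::euclidean_space set"
  assumes norm: "is_norm N" and prox: "prox_function N X d d'" and eps: "0 < \<epsilon>"
    and run: "amd_run N X d d' D f g \<epsilon> \<Theta>\<^sub>0 x pf pg K"
    and y: "y \<in> X" "g y \<le> 0" "d y \<le> \<Theta>\<^sub>0\<^sup>2"
  obtains j where "j \<in> prod_steps g \<epsilon> x K"
    "blinfun_apply (pf j) (x j - y) \<le> \<epsilon> * dual_norm N (pf j)"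
proof (rule ccontr)
  assume "\<not> thesis"
  with that have far: "\<epsilon> * dual_norm N (pf j) < pf j (x j - y)" if "j < K" "g (x j) \<le> \<epsilon>" for j
    using that by (force simp: prod_steps_def)
  have start: "is_arg_min d (\<lambda>u. u \<in> X) (x 0)"
    and step: "\<And>k. k < K \<Longrightarrow> amd_step N X d d' D f g \<epsilon> x pf pg k"
    and K: "1 \<le> K" and stop: "amd_stop N g \<epsilon> \<Theta>\<^sub>0 x pg K"
    using run by (auto simp: amd_run_def)
  define w where "w k = (if g (x k) \<le> \<epsilon> then 1 else 1 / (dual_norm N (pg k))\<^sup>2)" for k
  have dom: "x k \<in> subdiff_dom X d" if "k \<le> K" for k
    using that
  proof (induction k)
    case 0
    show ?case using bregman_initial(1)[OF prox start y(1)] .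
  next
    case (Suc k)
    then show ?case
      using amd_step_decrease(1)[OF norm prox eps _ step y(1,2) far] by simp
  qed
  let ?V = "\<lambda>k. bregman d d' (x k) y"
  have decrease: "\<epsilon>\<^sup>2 / 2 * w k < ?V k - ?V (Suc k)" if "k < K" for k
    using amd_step_decrease(2)[OF norm prox eps dom step y(1,2) far] that by (simp add: w_def)
  have "(\<Sum>k<K. w k) = (\<Sum>k\<in>prod_steps g \<epsilon> x K. w k) + (\<Sum>k\<in>nonprod_steps g \<epsilon> x K. w k)"
    unfolding nonprod_steps_def atLeast0LessThan
    by (subst sum.subset_diff[of "prod_steps g \<epsilon> x K"]) (auto simp: prod_steps_def)
  also have "(\<Sum>k\<in>prod_steps g \<epsilon> x K. w k) = real (card (prod_steps g \<epsilon> x K))"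
    by (simp add: w_def prod_steps_def)
  also have "(\<Sum>k\<in>nonprod_steps g \<epsilon> x K. w k)
      = (\<Sum>k\<in>nonprod_steps g \<epsilon> x K. 1 / (dual_norm N (pg k))\<^sup>2)"
    by (rule sum.cong) (auto simp: w_def nonprod_steps_def prod_steps_def)
  finally have "2 * \<Theta>\<^sub>0\<^sup>2 / \<epsilon>\<^sup>2 \<le> (\<Sum>k<K. w k)" using stop by (simp add: amd_stop_def)
  then have "\<Theta>\<^sub>0\<^sup>2 \<le> \<epsilon>\<^sup>2 / 2 * (\<Sum>k<K. w k)" using eps by (simp add: field_simps)
  also have "\<dots> = (\<Sum>k<K. \<epsilon>\<^sup>2 / 2 * w k)" by (simp add: sum_distrib_left)
  also have "\<dots> < (\<Sum>k<K. ?V k - ?V (Suc k))"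
    using K by (intro sum_strict_mono decrease) (auto simp: lessThan_empty_iff)
  also have "\<dots> = ?V 0 - ?V K" by (rule sum_lessThan_telescope')
  also have "\<dots> \<le> ?V 0"
  proof -
    have "0 \<le> (N (y - x K))\<^sup>2 / 2" by simp
    also have "\<dots> \<le> ?V K" using prox_functionD(4)[OF prox dom y(1)] by simp
    finally show ?thesis by simp
  qed
  also have "\<dots> \<le> \<Theta>\<^sub>0\<^sup>2" using bregman_initial(2)[OF prox start y(1)] y(3) by simp
  finally show False by simp
qed

section \<open>From the distance to a hyperplane to the objective\<close>

text \<open>
  The function \<open>\<phi>\<close> is the error of the quadratic upper model on the segment from \<open>a\<close> to \<open>b\<close>; the
  Lipschitz condition makes its derivative nonpositive. A derivative relative to \<open>S\<close> suffices, as
  the segment stays in \<open>S\<close>; this admits sets with empty interior and points on the boundary.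
\<close>

lemma descent_lemma:
  fixes f :: "'a::euclidean_space \<Rightarrow> real"
  assumes norm: "is_norm N" and S: "convex S"
    and diff: "\<And>z. z \<in> S \<Longrightarrow> (f has_derivative blinfun_apply (f' z)) (at z within S)"
    and smooth: "\<And>z y. z \<in> S \<Longrightarrow> y \<in> S \<Longrightarrow> dual_norm N (f' z - f' y) \<le> L * N (z - y)"
    and a: "a \<in> S" and b: "b \<in> S"
  shows "f b \<le> f a + blinfun_apply (f' a) (b - a) + L / 2 * (N (b - a))\<^sup>2"
proof -
  define h where "h = b - a"
  define \<gamma> where "\<gamma> t = a + t *\<^sub>R h" for t :: real
  define F where "F t = f (\<gamma> t)" for t
  define \<phi> where "\<phi> t = F t - t * f' a h - L / 2 * (N h)\<^sup>2 * t\<^sup>2" for t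
  have seg: "\<gamma> t \<in> S" if "t \<in> {0..1}" for t
  proof -
    have "(1 - t) *\<^sub>R a + t *\<^sub>R b \<in> S" using S a b that by (simp add: convex_alt)
    then show ?thesis by (simp add: \<gamma>_def h_def algebra_simps)
  qed
  have F: "(F has_derivative (\<lambda>s. s * f' (\<gamma> t) h)) (at t within {0..1})"
    if "t \<in> {0..1}" for t
  proof -
    have line: "(\<gamma> has_derivative (\<lambda>s. s *\<^sub>R h)) (at t within {0..1})"
      unfolding \<gamma>_def by (auto intro!: derivative_eq_intros)
    have "\<gamma> ` {0..1} \<subseteq> S" using seg by blast
    from has_derivative_in_compose2[OF diff this that line] show ?thesis
      by (simp add: F_def[abs_def] blinfun.scaleR_right)
  qed
  have "(\<phi> has_derivative (\<lambda>s. s * (f' (\<gamma> t) h - f' a h - L * (N h)\<^sup>2 * t))) (at t within {0..1})"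
    if "t \<in> {0..1}" for t
  proof -
    have "((\<lambda>t. t * f' a h + L / 2 * (N h)\<^sup>2 * t\<^sup>2) has_derivative
        (\<lambda>s. s * (f' a h + L * (N h)\<^sup>2 * t))) (at t within {0..1})"
      by (auto intro!: derivative_eq_intros simp: algebra_simps)
    from has_derivative_diff[OF F[OF that] this] show ?thesis
      by (simp add: \<phi>_def[abs_def] algebra_simps)
  qed
  then obtain t where t: "t \<in> {0<..<1}"
    and mvt: "\<phi> 1 - \<phi> 0 = (1 - 0) * (f' (\<gamma> t) h - f' a h - L * (N h)\<^sup>2 * t)"
    using mvt_simple[of 0 1 \<phi> "\<lambda>t s. s * (f' (\<gamma> t) h - f' a h - L * (N h)\<^sup>2 * t)"] by auto
  have "f' (\<gamma> t) h - f' a h \<le> dual_norm N (f' (\<gamma> t) - f' a) * N h"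
    using dual_norm_bound[OF norm, of "f' (\<gamma> t) - f' a" h] by (simp add: blinfun.diff_left)
  also have "\<dots> \<le> (L * N (\<gamma> t - a)) * N h"
    using smooth[OF seg a, of t] t is_normD(1)[OF norm, of h] by (intro mult_right_mono) auto
  also have "\<dots> = L * (N h)\<^sup>2 * t"
    using t by (simp add: \<gamma>_def is_normD(3)[OF norm] power2_eq_square)
  finally have "\<phi> 1 \<le> \<phi> 0" using mvt by simp
  then show ?thesis by (simp add: \<phi>_def F_def \<gamma>_def h_def)
qed

text \<open>It suffices to follow a component that attains the maximum at \<open>b\<close>.\<close>

lemma max_smooth_bound:
  fixes fi :: "nat \<Rightarrow> 'a::euclidean_space \<Rightarrow> real"
  assumes norm: "is_norm N" and I: "finite I" "I \<noteq> {}" and S: "convex S"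
    and diff: "\<And>i z. i \<in> I \<Longrightarrow> z \<in> S \<Longrightarrow> (fi i has_derivative blinfun_apply (fi' i z)) (at z within S)"
    and smooth: "\<And>i z y. i \<in> I \<Longrightarrow> z \<in> S \<Longrightarrow> y \<in> S \<Longrightarrow>
      dual_norm N (fi' i z - fi' i y) \<le> L i * N (z - y)"
    and a: "a \<in> S" and b: "b \<in> S"
  shows "(MAX i\<in>I. fi i b) - (MAX i\<in>I. fi i a)
    \<le> N (b - a) * (MAX i\<in>I. dual_norm N (fi' i a)) + (N (b - a))\<^sup>2 / 2 * (MAX i\<in>I. L i)"
proof -
  have "(MAX i\<in>I. fi i b) \<in> (\<lambda>i. fi i b) ` I" using I by (intro Max_in) auto
  then obtain i where i: "i \<in> I" "(MAX i\<in>I. fi i b) = fi i b" by auto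
  have le_Max: "h i \<le> (MAX i\<in>I. h i)" for h :: "nat \<Rightarrow> real"
    using i(1) I by (intro Max_ge) auto
  have "fi i b \<le> fi i a + fi' i a (b - a) + L i / 2 * (N (b - a))\<^sup>2"
    using descent_lemma[OF norm S diff smooth a b] i(1) by blast
  also have "fi' i a (b - a) \<le> N (b - a) * dual_norm N (fi' i a)"
    using dual_norm_bound[OF norm, of "fi' i a" "b - a"] by (simp add: mult.commute)
  also have "\<dots> \<le> N (b - a) * (MAX i\<in>I. dual_norm N (fi' i a))"
    using le_Max is_normD(1)[OF norm] by (intro mult_left_mono)
  also have "L i / 2 * (N (b - a))\<^sup>2 \<le> (N (b - a))\<^sup>2 / 2 * (MAX i\<in>I. L i)"
    using mult_left_mono[OF le_Max[of L], of "(N (b - a))\<^sup>2 / 2"] by (simp add: mult.commute)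
  finally show ?thesis using i(2) le_Max[of "\<lambda>i. fi i a"] by simp
qed

text \<open>
  Moving from \<open>y\<close> by \<open>\<epsilon>\<close> in the direction in which \<open>p\<close> attains its dual norm raises \<open>p\<close> by
  \<open>\<epsilon>\<close> times the dual norm, which makes up for the deficit \<open>p (x - y)\<close>.
\<close>

lemma subgradient_le_at_distance:
  fixes D :: "'a::euclidean_space set"
  assumes norm: "is_norm N" and sub: "is_subgradient D f x p"
    and near: "blinfun_apply p (x - y) \<le> \<epsilon> * dual_norm N p"
    and eps: "0 \<le> \<epsilon>" and ball: "{z. N (z - y) \<le> \<epsilon>} \<subseteq> D"
  obtains z where "N (z - y) = \<epsilon>" "f x \<le> f z"
proof -
  obtain e where e: "N e = 1" "p e = dual_norm N p"
    using dual_norm_attained[OF norm, of p] by blast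
  let ?z = "y + \<epsilon> *\<^sub>R e"
  have dist: "N (?z - y) = \<epsilon>" using e(1) eps by (simp add: is_normD(3)[OF norm])
  then have "?z \<in> D" using ball by auto
  then have "f x + p (?z - x) \<le> f ?z" using sub by (simp add: is_subgradient_def)
  moreover have "0 \<le> p (?z - x)"
    using near e(2) by (simp add: blinfun.add_right blinfun.diff_right blinfun.scaleR_right)
  ultimately show ?thesis using that[OF dist] by linarith
qed

section \<open>Accuracy of the output\<close>

theorem corollary1:
  fixes N :: "'a::euclidean_space \<Rightarrow> real"
    and X D :: "'a set"
    and f g d :: "'a \<Rightarrow> real"
    and d' :: "'a \<Rightarrow> 'a \<Rightarrow>\<^sub>L real"
    and m :: nat
    and fi :: "nat \<Rightarrow> 'a \<Rightarrow> real"
    and fi' :: "nat \<Rightarrow> 'a \<Rightarrow> 'a \<Rightarrow>\<^sub>L real"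
    and L :: "nat \<Rightarrow> real"
    and M\<^sub>g \<epsilon> \<Theta>\<^sub>0 :: real
    and x\<^sub>s xbar :: 'a
    and x :: "nat \<Rightarrow> 'a"
    and pf pg :: "nat \<Rightarrow> 'a \<Rightarrow>\<^sub>L real"
    and K :: nat
  assumes norm: "is_norm N"
    and X: "closed X" "convex X"
    and g_convex: "convex_on UNIV g"
    and regular: "\<exists>xb\<in>rel_interior X. g xb < 0"
    and prox: "prox_function N X d d'"
    and solution: "is_arg_min f (\<lambda>u. u \<in> X \<and> g u \<le> 0) x\<^sub>s"
    and D: "X \<subseteq> D" "{z. N (z - x\<^sub>s) \<le> \<epsilon>} \<subseteq> D"
    and f_convex: "convex_on D f"
    and m: "1 \<le> m"
    and f_max: "\<forall>z\<in>D. f z = (MAX i\<in>{1..m}. fi i z)"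
    and fi_diff: "\<forall>i\<in>{1..m}. \<forall>z\<in>D. (fi i has_derivative blinfun_apply (fi' i z)) (at z within D)"
    and fi_smooth: "\<forall>i\<in>{1..m}. \<forall>z\<in>D. \<forall>y\<in>D. dual_norm N (fi' i z - fi' i y) \<le> L i * N (z - y)"
    and g_Lipschitz: "\<forall>z\<in>X. \<forall>y\<in>X. \<bar>g z - g y\<bar> \<le> M\<^sub>g * N (z - y)"
    and Theta: "0 < \<Theta>\<^sub>0" "d x\<^sub>s \<le> \<Theta>\<^sub>0\<^sup>2"
    and eps: "0 < \<epsilon>"
    and run: "amd_run N X d d' D f g \<epsilon> \<Theta>\<^sub>0 x pf pg K"
    and out: "amd_output f g \<epsilon> x K xbar"
  defines "\<epsilon>' \<equiv> max \<epsilon> (\<epsilon> * (MAX i\<in>{1..m}. dual_norm N (fi' i x\<^sub>s)) + \<epsilon>\<^sup>2 / 2 * (MAX i\<in>{1..m}. L i))"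
  shows "f xbar - f x\<^sub>s \<le> \<epsilon>' \<and> g xbar \<le> \<epsilon>'"
proof
  have xs: "x\<^sub>s \<in> X" "g x\<^sub>s \<le> 0" using solution by (auto simp: is_arg_min_linorder)
  obtain k where k: "k \<in> prod_steps g \<epsilon> x K" "xbar = x k"
    and best: "\<And>j. j \<in> prod_steps g \<epsilon> x K \<Longrightarrow> f xbar \<le> f (x j)"
    using out by (auto simp: amd_output_def is_arg_min_linorder)
  show "g xbar \<le> \<epsilon>'" using k by (auto simp: prod_steps_def \<epsilon>'_def intro: max.coboundedI1)
  obtain j where j: "j \<in> prod_steps g \<epsilon> x K" "pf j (x j - x\<^sub>s) \<le> \<epsilon> * dual_norm N (pf j)"
    using amd_good_productive_step[OF norm prox eps run xs Theta(2)] .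
  then have "is_subgradient D f (x j) (pf j)"
    using run by (auto simp: amd_run_def amd_step_def prod_steps_def)
  then obtain z where z: "N (z - x\<^sub>s) = \<epsilon>" "f (x j) \<le> f z"
    using subgradient_le_at_distance[OF norm _ j(2) less_imp_le[OF eps] D(2)] by blast
  have in_D: "x\<^sub>s \<in> D" "z \<in> D" using xs(1) z(1) D by auto
  have convex_D: "convex D" using f_convex by (simp add: convex_on_def)
  have "f xbar \<le> f z" using best[OF j(1)] z(2) by linarith
  moreover have "f z - f x\<^sub>s \<le> \<epsilon> * (MAX i\<in>{1..m}. dual_norm N (fi' i x\<^sub>s)) + \<epsilon>\<^sup>2 / 2 * (MAX i\<in>{1..m}. L i)"
    using max_smooth_bound[OF norm, of "{1..m}" D fi fi' L x\<^sub>s z]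
      m convex_D fi_diff fi_smooth in_D f_max z(1) by simp
  ultimately show "f xbar - f x\<^sub>s \<le> \<epsilon>'" unfolding \<epsilon>'_def by linarith
qed

end
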